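(* For $\rho=\frac{47}{49}$, there are infinitely many distinct genuine pairs.
   Context: A rational triangle is a triangle with rational side lengths (its area need not be rational). For $\rho\in\mathbb{Q}\cap(-1,1)$ let $\theta\in(0,\pi)$ be the angle with $\cos\theta=\rho$. A genuine pair for $\rho$ is a pair $(T,I)$ of non-degenerate rational triangles such that $T$ has an angle equal to $\theta$, $I$ is isosceles, $T$ and $I$ have the same perimeter and the same area, and $T$ and $I$ are not congruent. Genuine pairs are counted up to homothety: $(T,I)$ and $(T',I')$ are regarded as the same pair if there is a common scaling factor $\lambda>0$ such that $T'$ is congruent to $\lambda T$ and $I'$ is congruent to $\lambda I$; otherwise they are distinct. *)

theory Defs
  imports "HOL-Analysis.Analysis"
begin

text \<open>A triangle in the Euclidean plane is given by its three vertices. Non-degeneracy and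
  rationality of the sides are separate predicates.\<close>

type_synonym triangle = "(real^2) \<times> (real^2) \<times> (real^2)"

fun verts :: "triangle \<Rightarrow> (real^2) set" where
  "verts (A, B, C) = {A, B, C}"

definition nondegenerate :: "triangle \<Rightarrow> bool" where
  "nondegenerate T \<longleftrightarrow> \<not> collinear (verts T)"

fun rational_sides :: "triangle \<Rightarrow> bool" where
  "rational_sides (A, B, C) \<longleftrightarrow> dist A B \<in> \<rat> \<and> dist B C \<in> \<rat> \<and> dist C A \<in> \<rat>"

definition rational_triangle :: "triangle \<Rightarrow> bool" where
  "rational_triangle T \<longleftrightarrow> nondegenerate T \<and> rational_sides T"

fun isosceles :: "triangle \<Rightarrow> bool" where
  "isosceles (A, B, C) \<longleftrightarrow> dist A B = dist A C \<or> dist B A = dist B C \<or> dist C A = dist C B"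

fun perimeter :: "triangle \<Rightarrow> real" where
  "perimeter (A, B, C) = dist A B + dist B C + dist C A"

definition area :: "triangle \<Rightarrow> real" where
  "area T = measure lebesgue (convex hull (verts T))"

text \<open>The angle at the middle argument \<open>Q\<close>, in \<open>[0, pi]\<close>; meaningful when \<open>P\<close> and \<open>R\<close>
  both differ from \<open>Q\<close>.\<close>

definition angle_at :: "real^2 \<Rightarrow> real^2 \<Rightarrow> real^2 \<Rightarrow> real" where
  "angle_at P Q R = arccos (((P - Q) \<bullet> (R - Q)) / (norm (P - Q) * norm (R - Q)))"

fun has_angle :: "triangle \<Rightarrow> real \<Rightarrow> bool" where
  "has_angle (A, B, C) \<theta> \<longleftrightarrow>
     angle_at B A C = \<theta> \<or> angle_at A B C = \<theta> \<or> angle_at A C B = \<theta>"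

text \<open>Congruence by an isometry of the plane (reflections allowed) that may permute the order in
  which the vertices are listed.\<close>

definition congruent_triangles :: "triangle \<Rightarrow> triangle \<Rightarrow> bool" where
  "congruent_triangles T T' \<longleftrightarrow>
     (\<exists>f :: real^2 \<Rightarrow> real^2. (\<forall>x y. dist (f x) (f y) = dist x y) \<and> f ` verts T = verts T')"

fun scale_triangle :: "real \<Rightarrow> triangle \<Rightarrow> triangle" where
  "scale_triangle c (A, B, C) = (c *\<^sub>R A, c *\<^sub>R B, c *\<^sub>R C)"

text \<open>For \<open>-1 < \<rho> < 1\<close>, \<open>arccos \<rho>\<close> is the unique angle in \<open>(0, pi)\<close> with cosine \<open>\<rho>\<close>.\<close>

definition genuine_pairs :: "real \<Rightarrow> (triangle \<times> triangle) set" where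
  "genuine_pairs \<rho> = {(T, I).
     rational_triangle T \<and> rational_triangle I \<and>
     has_angle T (arccos \<rho>) \<and> isosceles I \<and>
     perimeter T = perimeter I \<and> area T = area I \<and>
     \<not> congruent_triangles T I}"

definition same_pair :: "real \<Rightarrow> ((triangle \<times> triangle) \<times> (triangle \<times> triangle)) set" where
  "same_pair \<rho> = {((T, I), (T', I')).
     (T, I) \<in> genuine_pairs \<rho> \<and> (T', I') \<in> genuine_pairs \<rho> \<and>
     (\<exists>c>0. congruent_triangles T' (scale_triangle c T) \<and>
            congruent_triangles I' (scale_triangle c I))}"

lemma verts_scale_triangle: "verts (scale_triangle c T) = (*\<^sub>R) c ` verts T"
  by (cases T) auto

lemma congruent_triangles_refl: "congruent_triangles T T"
  unfolding congruent_triangles_def by (rule exI[of _ id]) simp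

lemma congruent_triangles_trans:
  assumes "congruent_triangles T U" "congruent_triangles U V"
  shows "congruent_triangles T V"
proof -
  obtain f g :: "real^2 \<Rightarrow> real^2"
    where f: "\<forall>x y. dist (f x) (f y) = dist x y" "f ` verts T = verts U"
      and g: "\<forall>x y. dist (g x) (g y) = dist x y" "g ` verts U = verts V"
    using assms unfolding congruent_triangles_def by blast
  have "(g \<circ> f) ` verts T = verts V"
    by (simp only: image_comp[symmetric] f g)
  moreover have "\<forall>x y. dist ((g \<circ> f) x) ((g \<circ> f) y) = dist x y"
    by (simp add: f g)
  ultimately show ?thesis
    unfolding congruent_triangles_def by blast
qed

lemma congruent_triangles_sym:
  assumes "congruent_triangles T U"
  shows "congruent_triangles U T"
proof -
  obtain f :: "real^2 \<Rightarrow> real^2"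
    where f: "\<And>x y. dist (f x) (f y) = dist x y" "f ` verts T = verts U"
    using assms unfolding congruent_triangles_def by blast
  define h where "h = (\<lambda>x. f x - f 0)"
  have "dist (h x) (h y) = dist x y" for x y
    using f(1)[of x y] by (simp add: h_def dist_norm)
  hence h: "orthogonal_transformation h"
    by (simp add: orthogonal_transformation_isometry h_def)
  have "y = f (inv h (y - f 0))" for y
    using surj_f_inv_f[OF orthogonal_transformation_surj[OF h], of "y - f 0"]
    by (simp add: h_def algebra_simps)
  hence "surj f" by (rule surjI[OF sym])
  moreover have "inj f"
    by (rule injI) (metis f(1) dist_eq_0_iff)
  ultimately have "dist (inv f x) (inv f y) = dist x y" for x y
    by (metis f(1) surj_f_inv_f)
  moreover have "inv f ` verts U = verts T"
    using \<open>inj f\<close> by (simp add: f(2)[symmetric] image_inv_f_f)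
  ultimately show ?thesis unfolding congruent_triangles_def by blast
qed

lemma congruent_triangles_scale:
  assumes "congruent_triangles T U" "c > 0"
  shows "congruent_triangles (scale_triangle c T) (scale_triangle c U)"
proof -
  obtain f :: "real^2 \<Rightarrow> real^2"
    where f: "\<And>x y. dist (f x) (f y) = dist x y" "f ` verts T = verts U"
    using assms unfolding congruent_triangles_def by blast
  define g where "g = (\<lambda>x. c *\<^sub>R f ((1/c) *\<^sub>R x))"
  have "dist (c *\<^sub>R u) (c *\<^sub>R v) = c * dist u v" for u v :: "real^2"
    using \<open>c > 0\<close> by (simp add: dist_norm scaleR_right_diff_distrib[symmetric])
  moreover have "dist ((1/c) *\<^sub>R u) ((1/c) *\<^sub>R v) = (1/c) * dist u v" for u v :: "real^2"
    using \<open>c > 0\<close> by (simp add: dist_norm scaleR_right_diff_distrib[symmetric])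
  ultimately have "dist (g x) (g y) = dist x y" for x y
    using \<open>c > 0\<close> by (simp add: g_def f(1))
  moreover have "g ` verts (scale_triangle c T) = verts (scale_triangle c U)"
    using \<open>c > 0\<close>
    by (simp add: g_def verts_scale_triangle image_image f(2)[symmetric])
  ultimately show ?thesis unfolding congruent_triangles_def by blast
qed

lemma scale_triangle_scale_triangle: "scale_triangle c (scale_triangle d T) = scale_triangle (c * d) T"
  by (cases T) auto

lemma scale_triangle_1: "scale_triangle 1 T = T"
  by (cases T) auto

lemma equiv_same_pair: "equiv (genuine_pairs \<rho>) (same_pair \<rho>)"
proof (rule equivI)
  show "same_pair \<rho> \<subseteq> genuine_pairs \<rho> \<times> genuine_pairs \<rho>"
    by (auto simp: same_pair_def)
  show "refl_on (genuine_pairs \<rho>) (same_pair \<rho>)"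
    unfolding refl_on_def same_pair_def
    by (auto intro!: exI[of _ "1::real"] simp: scale_triangle_1 congruent_triangles_refl)
  have inv: "congruent_triangles T (scale_triangle (1/c) T')"
    if "congruent_triangles T' (scale_triangle c T)" "c > 0" for T T' c
    using congruent_triangles_scale[OF congruent_triangles_sym[OF that(1)], of "1/c"] that(2)
    by (simp add: scale_triangle_scale_triangle scale_triangle_1)
  show "sym (same_pair \<rho>)"
  proof (rule symI)
    fix p q assume "(p, q) \<in> same_pair \<rho>"
    then obtain T I T' I' c where pq: "p = (T, I)" "q = (T', I')"
      and g: "(T, I) \<in> genuine_pairs \<rho>" "(T', I') \<in> genuine_pairs \<rho>" and "c > 0"
      and c: "congruent_triangles T' (scale_triangle c T)" "congruent_triangles I' (scale_triangle c I)"
      unfolding same_pair_def by blast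
    have "1/c > 0" using \<open>c > 0\<close> by simp
    with inv[OF c(1) \<open>c > 0\<close>] inv[OF c(2) \<open>c > 0\<close>] show "(q, p) \<in> same_pair \<rho>"
      unfolding same_pair_def using g pq by blast
  qed
  have comp: "congruent_triangles T'' (scale_triangle (d * c) T)"
    if "congruent_triangles T' (scale_triangle c T)"
       "congruent_triangles T'' (scale_triangle d T')" "d > 0" for T T' T'' c d
    using congruent_triangles_trans[OF that(2) congruent_triangles_scale[OF that(1,3)]]
    by (simp add: scale_triangle_scale_triangle)
  show "trans (same_pair \<rho>)"
  proof (rule transI)
    fix p q r assume "(p, q) \<in> same_pair \<rho>" "(q, r) \<in> same_pair \<rho>"
    then obtain T I T' I' T'' I'' c d where pqr: "p = (T, I)" "r = (T'', I'')"
      and g: "(T, I) \<in> genuine_pairs \<rho>" "(T'', I'') \<in> genuine_pairs \<rho>" and "c > 0" "d > 0"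
      and c: "congruent_triangles T' (scale_triangle c T)" "congruent_triangles I' (scale_triangle c I)"
      and d: "congruent_triangles T'' (scale_triangle d T')" "congruent_triangles I'' (scale_triangle d I')"
      unfolding same_pair_def by blast
    have "d * c > 0" using \<open>c > 0\<close> \<open>d > 0\<close> by simp
    with comp[OF c(1) d(1) \<open>d > 0\<close>] comp[OF c(2) d(2) \<open>d > 0\<close>] show "(p, r) \<in> same_pair \<rho>"
      unfolding same_pair_def using g pqr by blast
  qed
qed

end

theory Submission
  imports Defs
begin

text \<open>A triangle is described by its tangent lengths \<open>x, y, z\<close>, normalised by \<open>x + y + z = 1\<close>, so that
  the squared area is \<open>x y z\<close>. The vertex with tangent length \<open>x\<close> has the angle \<open>\<theta>\<close> with
  \<open>cos \<theta> = 47/49\<close> exactly when \<open>y z = x tan\<^sup>2 (\<theta>/2) = x/48\<close>. An isosceles triangle with tangent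
  lengths \<open>q, p, p\<close> has the same area if \<open>x\<^sup>2/48 = q p\<^sup>2\<close>; this is solved by \<open>q = 3 w\<^sup>2\<close>,
  \<open>p = (1 - 3 w\<^sup>2)/2\<close>, \<open>x = 12 p w\<close>. Rational \<open>y\<close> and \<open>z\<close> then exist exactly when
  \<open>(1 - x)\<^sup>2 - x/12\<close> is a rational square. For this angle that sextic in \<open>w\<close> has a double root, and
  the condition becomes \<open>v\<^sup>2 = Q(w)\<close> with the quartic
  \<open>Q(w) = 36 w\<^sup>4 + 24 w\<^sup>3 - 12 w\<^sup>2 - 13/2 w + 1\<close>. So \<open>genuine_pair_exists\<close> turns every rational point
  of this curve with \<open>1/2 < w < 1 / sqrt 3\<close> into a genuine pair, and \<open>isosceles_of_similar\<close> shows
  that different \<open>w\<close> give different pairs.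

  The quartic curve is birational to the elliptic curve \<open>E: y\<^sup>2 = z (z\<^sup>2 + 33 z + 15)\<close>, and the
  admissible \<open>w\<close> include those coming from \<open>z > 250\<close> (\<open>curve_point_parameter\<close>). Hence it suffices
  that \<open>E\<close> has rational points with arbitrarily large \<open>z\<close>. That \<open>E\<close> has infinitely many
  rational points follows from repeated doubling, under which the 2-adic valuation of \<open>z\<close> decreases
  strictly (\<open>infinite_curve_points\<close>). That \<open>z\<close> is unbounded follows from compactness: infinitely many
  points accumulate on the real curve, and the difference of two nearby points is close to the
  neutral element at infinity (\<open>curve_points_unbounded\<close>).\<close>

section \<open>Triangles with given tangent lengths\<close>

text \<open>The triangle whose tangent lengths (distances from the vertices to the points where the incircle
  touches the adjacent sides) are \<open>x\<close>, \<open>y\<close>, \<open>z\<close>: its sides are \<open>x + y\<close>, \<open>y + z\<close>, \<open>z + x\<close>. In these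
  coordinates the triangle inequality is positivity, the semiperimeter is \<open>x + y + z\<close>, and the square
  of the area is \<open>(x + y + z) x y z\<close>. The first vertex, with tangent length \<open>x\<close>, is the origin and
  the second lies on the first axis.\<close>

definition tangent_triangle :: "real \<Rightarrow> real \<Rightarrow> real \<Rightarrow> triangle" where
  "tangent_triangle x y z =
     (0, vector [x + y, 0],
      vector [(x\<^sup>2 + x * y + x * z - y * z) / (x + y), 2 * sqrt ((x + y + z) * x * y * z) / (x + y)])"

lemma dist_vector2: "dist (vector [a, b] :: real^2) (vector [c, d]) = sqrt ((a - c)\<^sup>2 + (b - d)\<^sup>2)"
  by (simp add: dist_norm norm_vec_def L2_set_def sum_2)

lemma tangent_triangle_vertices:
  assumes "x > 0" "y > 0" "z > 0"
  obtains B C where "tangent_triangle x y z = (0, B, C)"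
    "dist 0 B = x + y" "dist B C = y + z" "dist C 0 = z + x" "\<not> collinear {0, B, C}"
    "B \<bullet> C = x\<^sup>2 + x * y + x * z - y * z"
proof -
  define c where "c = x + y"
  define k where "k = x\<^sup>2 + x * y + x * z - y * z"
  define h where "h = 2 * sqrt ((x + y + z) * x * y * z)"
  define B :: "real^2" where "B = vector [c, 0]"
  define C :: "real^2" where "C = vector [k / c, h / c]"
  have c: "c > 0" using assms by (simp add: c_def)
  have h: "h > 0" "h\<^sup>2 = 4 * ((x + y + z) * x * y * z)"
    using assms by (auto simp: h_def power_mult_distrib)
  have 0: "(0 :: real^2) = vector [0, 0]" by (simp add: vec_eq_iff forall_2)
  have "dist 0 B = sqrt (c\<^sup>2)" unfolding 0 B_def dist_vector2 by simp
  hence 1: "dist 0 B = x + y" using c by (simp add: c_def)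
  have "dist C 0 = sqrt ((k\<^sup>2 + h\<^sup>2) / c\<^sup>2)"
    unfolding 0 C_def dist_vector2 by (simp add: power_divide add_divide_distrib)
  also have "k\<^sup>2 + h\<^sup>2 = ((z + x) * c)\<^sup>2" unfolding h k_def c_def by algebra
  finally have 2: "dist C 0 = z + x" using c assms by (simp add: power_mult_distrib)
  have "c - k / c = (c\<^sup>2 - k) / c" using c by (simp add: field_simps power2_eq_square)
  hence "dist B C = sqrt (((c\<^sup>2 - k)\<^sup>2 + h\<^sup>2) / c\<^sup>2)"
    unfolding B_def C_def dist_vector2 by (simp add: power_divide add_divide_distrib)
  also have "(c\<^sup>2 - k)\<^sup>2 + h\<^sup>2 = ((y + z) * c)\<^sup>2" unfolding h k_def c_def by algebra
  finally have 3: "dist B C = y + z" using c assms by (simp add: power_mult_distrib)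
  have "B $ 1 \<noteq> 0" "B $ 2 = 0" "C $ 2 \<noteq> 0" using c h by (auto simp: B_def C_def)
  hence 4: "\<not> collinear {0, B, C}" by (auto simp: collinear_lemma)
  have 5: "B \<bullet> C = k" using c by (simp add: B_def C_def inner_vec_def sum_2)
  show thesis
    by (rule that[OF _ 1 3 2 4 5[unfolded k_def]])
       (simp add: tangent_triangle_def B_def C_def c_def k_def h_def)
qed

lemma rational_tangent_triangle:
  assumes "x > 0" "y > 0" "z > 0" "x \<in> \<rat>" "y \<in> \<rat>" "z \<in> \<rat>"
  shows "rational_triangle (tangent_triangle x y z)"
proof -
  obtain B C where "tangent_triangle x y z = (0, B, C)"
    "dist 0 B = x + y" "dist B C = y + z" "dist C 0 = z + x" "\<not> collinear {0, B, C}"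
    using tangent_triangle_vertices[OF assms(1-3)] by metis
  thus ?thesis using assms(4-6) by (simp add: rational_triangle_def nondegenerate_def)
qed

lemma perimeter_tangent_triangle:
  assumes "x > 0" "y > 0" "z > 0"
  shows "perimeter (tangent_triangle x y z) = 2 * (x + y + z)"
proof -
  obtain B C where "tangent_triangle x y z = (0, B, C)"
    "dist 0 B = x + y" "dist B C = y + z" "dist C 0 = z + x"
    using tangent_triangle_vertices[OF assms] by metis
  thus ?thesis by simp
qed

lemma area_tangent_triangle:
  assumes "x > 0" "y > 0" "z > 0"
  shows "area (tangent_triangle x y z) = sqrt ((x + y + z) * x * y * z)"
proof -
  obtain B C where T: "tangent_triangle x y z = (0, B, C)"
    and d: "dist 0 B = x + y" "dist B C = y + z" "dist C 0 = z + x"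
    using tangent_triangle_vertices[OF assms] by metis
  have "area (tangent_triangle x y z) = measure lborel (convex hull {0, B, C})"
    unfolding area_def T verts.simps
    by (intro measure_completion) (auto intro!: borel_compact finite_imp_compact_convex_hull)
  also have "\<dots> = sqrt ((x + y + z) * ((x + y + z) - (y + z)) *
      ((x + y + z) - (z + x)) * ((x + y + z) - (x + y)))"
  proof -
    have s: "(y + z + (z + x) + (x + y)) / 2 = x + y + z" by simp
    show ?thesis using heron[of 0 B C] unfolding dist_commute[of 0 C] d s .
  qed
  also have "\<dots> = sqrt ((x + y + z) * x * y * z)" by simp
  finally show ?thesis .
qed

lemma isosceles_tangent_triangle:
  assumes "x > 0" "y > 0"
  shows "isosceles (tangent_triangle x y y)"
proof -
  obtain B C where "tangent_triangle x y y = (0, B, C)" "dist 0 B = x + y" "dist C 0 = y + x"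
    using tangent_triangle_vertices[OF assms assms(2)] by metis
  thus ?thesis by (simp add: dist_commute[of 0 C])
qed

lemma has_angle_tangent_triangle:
  assumes "x > 0" "y > 0" "z > 0"
  shows "has_angle (tangent_triangle x y z)
           (arccos ((x\<^sup>2 + x * y + x * z - y * z) / ((x + y) * (z + x))))"
proof -
  obtain B C where "tangent_triangle x y z = (0, B, C)"
    "dist 0 B = x + y" "dist C 0 = z + x" "B \<bullet> C = x\<^sup>2 + x * y + x * z - y * z"
    using tangent_triangle_vertices[OF assms] by metis
  thus ?thesis by (simp add: angle_at_def)
qed

section \<open>The set of distances as a congruence invariant\<close>

text \<open>A congruence invariant, used to tell triangles apart. It forgets multiplicities, and always
  contains 0 because a vertex is paired with itself.\<close>

definition distances :: "triangle \<Rightarrow> real set" where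
  "distances T = (\<Union>P\<in>verts T. dist P ` verts T)"

lemma distances_congruent:
  assumes "congruent_triangles T U"
  shows "distances T = distances U"
proof -
  obtain f where f: "\<And>x y. dist (f x) (f y) = dist x y" "f ` verts T = verts U"
    using assms unfolding congruent_triangles_def by blast
  show ?thesis unfolding distances_def f(2)[symmetric]
    by (simp add: image_image f(1))
qed

lemma distances_scale:
  assumes "c > 0"
  shows "distances (scale_triangle c T) = (*) c ` distances T"
proof -
  have "dist (c *\<^sub>R P) (c *\<^sub>R Q) = c * dist P Q" for P Q :: "real^2"
    using assms by (simp add: dist_norm flip: scaleR_diff_right)
  thus ?thesis unfolding distances_def verts_scale_triangle
    by (simp add: image_image image_UN)
qed

lemma distances_tangent_triangle:
  assumes "x > 0" "y > 0" "z > 0"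
  shows "distances (tangent_triangle x y z) = {0, x + y, y + z, z + x}"
proof -
  obtain B C where T: "tangent_triangle x y z = (0, B, C)"
    and d: "dist 0 B = x + y" "dist B C = y + z" "dist C 0 = z + x"
    using tangent_triangle_vertices[OF assms] by metis
  have d': "dist B 0 = x + y" "dist C B = y + z" "dist 0 C = z + x"
    using d by (simp_all add: dist_commute)
  show ?thesis unfolding distances_def T verts.simps
    by (simp only: UN_insert UN_empty image_insert image_empty dist_self d d') blast
qed

section \<open>Genuine pairs from points on a quartic curve\<close>

text \<open>The isosceles triangle of semiperimeter 1 with base \<open>1 - 3 w\<^sup>2\<close>. The factor 3 is the
  square class of \<open>1/48 = tan\<^sup>2 (\<theta>/2)\<close> for \<open>cos \<theta> = 47/49\<close>; equality of the areas forces the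
  tangent length at the apex to be of the form \<open>3 w\<^sup>2\<close>.\<close>

definition isosceles_of :: "real \<Rightarrow> triangle" where
  "isosceles_of w = tangent_triangle (3 * w\<^sup>2) ((1 - 3 * w\<^sup>2) / 2) ((1 - 3 * w\<^sup>2) / 2)"

text \<open>With semiperimeter 1, the angle condition on \<open>T\<close> reads \<open>y z = x/48\<close>, and the tangent lengths
  \<open>q, p, p\<close> of \<open>I\<close> satisfy \<open>q + 2 p = 1\<close>. The areas agree if \<open>x\<^sup>2/48 = q p\<^sup>2\<close>, that is, if
  \<open>x = 12 p w\<close>. It remains to split \<open>1 - x\<close> into rational \<open>y\<close> and \<open>z\<close> with product \<open>x/48\<close>, which
  requires the discriminant \<open>(1 - x)\<^sup>2 - x/12\<close> to be a square. This is a sextic in \<open>w\<close> with the double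
  root \<open>1/3\<close>, and dividing it by \<open>(3 w - 1)\<^sup>2\<close> leaves the quartic \<open>Q(w)\<close> below. The two bounds on
  \<open>w\<close> guarantee \<open>0 < x < 1\<close> and \<open>p > 0\<close>, and also \<open>p < x < q\<close>, which excludes a congruence:
  the tangent length \<open>x\<close> of \<open>T\<close> does not occur in \<open>I\<close>.\<close>

lemma genuine_pair_exists:
  assumes w: "w \<in> \<rat>" "w > 1/2" "3 * w\<^sup>2 < 1"
    and v: "v \<in> \<rat>" "v\<^sup>2 = 36 * w^4 + 24 * w^3 - 12 * w\<^sup>2 - 13/2 * w + 1"
  shows "\<exists>T. (T, isosceles_of w) \<in> genuine_pairs (47/49)"
proof -
  define q p x where "q = 3 * w\<^sup>2" and "p = (1 - q) / 2" and "x = 12 * p * w"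
  define r where "r = (3 * w - 1) * v"
  define y z where "y = (1 - x + r) / 2" and "z = (1 - x - r) / 2"
  have w2: "w\<^sup>2 > 1/4" using power_strict_mono[of "1/2" w 2] w by (simp add: power2_eq_square)
  have q: "3/4 < q" "q < 1" using w w2 by (auto simp: q_def)
  have p: "0 < p" "p < 1/8" using q by (auto simp: p_def)
  have w1: "w < 3/5"
  proof (rule ccontr)
    assume "\<not> w < 3/5"
    hence "(3/5)\<^sup>2 \<le> w\<^sup>2" by (intro power_mono) auto
    thus False using w(3) by (simp add: power2_eq_square)
  qed
  have x: "0 < x" "x < 1"
  proof -
    show "0 < x" using p w by (simp add: x_def)
    have "p * w < 1/8 * (3/5)" using p w w1 by (intro mult_strict_mono) auto
    thus "x < 1" by (simp add: x_def)
  qed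
  have s: "x + y + z = 1" "y + z = 1 - x" by (auto simp: y_def z_def field_simps)
  have "(1 - x)\<^sup>2 - r\<^sup>2 = x / 12"
    unfolding r_def power_mult_distrib v(2) x_def p_def q_def by (simp add: field_simps) algebra
  hence yz: "y * z = x / 48" by (simp add: y_def z_def field_simps power2_eq_square)
  have "y > 0" "z > 0"
  proof -
    have "y * z > 0" "y + z > 0" using yz s x by auto
    thus "y > 0" "z > 0" by (auto simp: zero_less_mult_iff)
  qed
  note pos = x(1) this
  have rat: "q \<in> \<rat>" "p \<in> \<rat>" "x \<in> \<rat>" "y \<in> \<rat>" "z \<in> \<rat>"
  proof -
    show q: "q \<in> \<rat>" using w by (simp add: q_def)
    thus p: "p \<in> \<rat>" by (simp add: p_def)
    thus x: "x \<in> \<rat>" using w by (simp add: x_def)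
    have "r \<in> \<rat>" using w v by (simp add: r_def)
    thus "y \<in> \<rat>" "z \<in> \<rat>" using x by (simp_all add: y_def z_def)
  qed
  define T where "T = tangent_triangle x y z"
  have I: "isosceles_of w = tangent_triangle q p p" by (simp add: isosceles_of_def p_def q_def)
  have qpos: "q > 0" using q by simp
  have "rational_triangle T" unfolding T_def by (intro rational_tangent_triangle pos rat)
  moreover have "rational_triangle (isosceles_of w)"
    unfolding I by (intro rational_tangent_triangle p qpos rat)
  moreover have "has_angle T (arccos (47/49))"
  proof -
    have "x\<^sup>2 + x * y + x * z - y * z = x * (x + y + z) - y * z" by algebra
    hence 1: "x\<^sup>2 + x * y + x * z - y * z = 47/48 * x" using s yz by simp
    have "(x + y) * (z + x) = x * (x + y + z) + y * z" by algebra
    hence 2: "(x + y) * (z + x) = 49/48 * x" using s yz by simp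
    show ?thesis using has_angle_tangent_triangle[OF pos] x unfolding 1 2 T_def by simp
  qed
  moreover have "isosceles (isosceles_of w)"
    unfolding I by (rule isosceles_tangent_triangle[OF qpos p(1)])
  moreover have "perimeter T = perimeter (isosceles_of w)"
    unfolding T_def I perimeter_tangent_triangle[OF pos] perimeter_tangent_triangle[OF qpos p(1) p(1)]
    using s by (simp add: p_def field_simps)
  moreover have "area T = area (isosceles_of w)"
  proof -
    have "(x + y + z) * x * y * z = x * (y * z)" using s by simp
    also have "\<dots> = x * x / 48" unfolding yz by simp
    also have "\<dots> = q * p * p" unfolding x_def q_def by (simp add: power2_eq_square)
    also have "\<dots> = (q + p + p) * q * p * p" by (simp add: p_def field_simps)
    finally show ?thesis
      unfolding T_def I area_tangent_triangle[OF pos] area_tangent_triangle[OF qpos p(1) p(1)] by simp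
  qed
  moreover have "\<not> congruent_triangles T (isosceles_of w)"
  proof
    assume "congruent_triangles T (isosceles_of w)"
    from distances_congruent[OF this]
    have "{0, x + y, y + z, z + x} = {0, q + p, p + p, p + q}"
      unfolding T_def I distances_tangent_triangle[OF pos] distances_tangent_triangle[OF qpos p(1) p(1)] .
    \<comment> \<open>the side \<open>y + z = 1 - x\<close> of \<open>T\<close>, opposite the prescribed angle, would have to be one of
      0, \<open>1 - p\<close> and \<open>1 - q\<close>\<close>
    hence "y + z \<in> {0, q + p, p + p, p + q}" by blast
    hence "x = 1 \<or> x = p \<or> x = q" using s by (auto simp: p_def field_simps)
    moreover have "x > p" using p w by (simp add: x_def)
    moreover have "x < q"
    proof -
      have "p * w < 1/8 * w" using p w by simp
      hence "x < 3 / 2 * w" by (simp add: x_def)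
      also have "\<dots> < q" using w by (simp add: q_def power2_eq_square)
      finally show ?thesis .
    qed
    ultimately show False using x by auto
  qed
  ultimately show ?thesis unfolding genuine_pairs_def by blast
qed

text \<open>For \<open>w > 1/2\<close> the base is shorter than the legs, so a similarity matches base with base and
  legs with legs; the common perimeter 2 then makes the scaling factor 1, and the leg determines
  \<open>w\<close>.\<close>

lemma isosceles_of_similar:
  assumes "w > 1/2" "3 * w\<^sup>2 < 1" "w' > 1/2" "3 * w'\<^sup>2 < 1" "c > 0"
    and "congruent_triangles (isosceles_of w') (scale_triangle c (isosceles_of w))"
  shows "w' = w"
proof -
  have D: "distances (isosceles_of u) = {0, 1 - 3 * u\<^sup>2, (1 + 3 * u\<^sup>2) / 2}"
       "0 < 1 - 3 * u\<^sup>2" "1 - 3 * u\<^sup>2 < (1 + 3 * u\<^sup>2) / 2"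
    if "u > 1/2" "3 * u\<^sup>2 < 1" for u :: real
  proof -
    have "u\<^sup>2 > 1/4" using power_strict_mono[of "1/2" u 2] that by (simp add: power2_eq_square)
    thus "0 < 1 - 3 * u\<^sup>2" "1 - 3 * u\<^sup>2 < (1 + 3 * u\<^sup>2) / 2" using that by auto
    show "distances (isosceles_of u) = {0, 1 - 3 * u\<^sup>2, (1 + 3 * u\<^sup>2) / 2}"
      unfolding isosceles_of_def using that \<open>u\<^sup>2 > 1/4\<close>
      by (subst distances_tangent_triangle) (auto simp: field_simps)
  qed
  define n m n' m' where "n = 1 - 3 * w\<^sup>2" and "m = (1 + 3 * w\<^sup>2) / 2"
    and "n' = 1 - 3 * w'\<^sup>2" and "m' = (1 + 3 * w'\<^sup>2) / 2"
  have o: "0 < n" "n < m" "0 < n'" "n' < m'"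
    using D(2,3)[of w] D(2,3)[of w'] assms by (auto simp: n_def m_def n'_def m'_def)
  hence o2: "0 < c * n" "c * n < c * m" using assms(5) by auto
  have "{0, n', m'} = {0, c * n, c * m}"
    using distances_congruent[OF assms(6)] D(1)[OF assms(1,2)] D(1)[OF assms(3,4)]
    by (simp add: distances_scale[OF assms(5)] n_def m_def n'_def m'_def)
  \<comment> \<open>both sets are listed in strictly increasing order\<close>
  hence "n' = c * n" "m' = c * m" using o o2
    by (smt (verit) insert_iff empty_iff)+
  moreover have "n + 2 * m = 2" "n' + 2 * m' = 2" by (simp_all add: n_def m_def n'_def m'_def add_divide_distrib)
  ultimately have "c * 2 = 2" by (metis distrib_left mult.left_commute)
  hence "m' = m" using \<open>m' = c * m\<close> by simp
  hence "w'\<^sup>2 = w\<^sup>2" by (simp add: m_def m'_def)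
  thus ?thesis using assms by (simp add: power2_eq_iff_nonneg)
qed

section \<open>Rational points on the elliptic curve\<close>

text \<open>The \<open>z\<close>-coordinates of the rational points with \<open>z > 0\<close> on the elliptic curve
  \<open>E: y\<^sup>2 = z (z\<^sup>2 + 33 z + 15)\<close>. Its real locus is an oval with \<open>z < 0\<close> and an unbounded branch
  with \<open>z \<ge> 0\<close>; the sign of \<open>y\<close> is immaterial, so only \<open>z\<close> is recorded.\<close>

definition curve_points :: "real set" where
  "curve_points = {z \<in> \<rat>. z > 0 \<and> (\<exists>y\<in>\<rat>. y\<^sup>2 = z * (z\<^sup>2 + 33 * z + 15))}"

text \<open>The \<open>z\<close>-coordinate of \<open>2P\<close> in the group law of \<open>E\<close>, for \<open>P = (z, y)\<close>.\<close>

definition double_z :: "real \<Rightarrow> real" where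
  "double_z z = (z\<^sup>2 - 15)\<^sup>2 / (4 * (z * (z\<^sup>2 + 33 * z + 15)))"

lemma curve_pointsI:
  "z \<in> \<rat> \<Longrightarrow> z > 0 \<Longrightarrow> y \<in> \<rat> \<Longrightarrow> y\<^sup>2 = z * (z\<^sup>2 + 33 * z + 15) \<Longrightarrow> z \<in> curve_points"
  unfolding curve_points_def by blast

lemma curve_pointsE:
  assumes "z \<in> curve_points"
  obtains y where "z \<in> \<rat>" "z > 0" "y \<in> \<rat>" "y > 0" "y\<^sup>2 = z * (z\<^sup>2 + 33 * z + 15)"
proof -
  obtain y where y: "z \<in> \<rat>" "z > 0" "y \<in> \<rat>" "y\<^sup>2 = z * (z\<^sup>2 + 33 * z + 15)"
    using assms unfolding curve_points_def by blast
  have "z * (z\<^sup>2 + 33 * z + 15) > 0"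
    using y(2) by (simp add: add_pos_pos)
  hence "\<bar>y\<bar> > 0" unfolding y(4)[symmetric] by simp
  thus thesis using y by (intro that[of "\<bar>y\<bar>"]) auto
qed

text \<open>The duplication formula. With \<open>B = y\<^sup>2\<close>, the new \<open>z\<close>-coordinate is the square of
  \<open>(z\<^sup>2 - 15) / (2 y)\<close>, and the quadratic factor at it is the square of \<open>n / (4 B)\<close>, where \<open>n\<close> is
  the quartic \<open>x\<^sup>4 + 2ax\<^sup>3 + 6bx\<^sup>2 + 2abx + b\<^sup>2\<close> attached to a general curve
  \<open>y\<^sup>2 = x (x\<^sup>2 + ax + b)\<close>. A point with \<open>z\<^sup>2 = 15\<close> would have the double \<open>(0, 0)\<close>, which
  violates \<open>z > 0\<close>.\<close>

lemma double_curve_points: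
  assumes "z \<in> curve_points" and "z\<^sup>2 \<noteq> 15"
  shows "double_z z \<in> curve_points"
proof -
  obtain y where z: "z \<in> \<rat>" "z > 0" and y: "y \<in> \<rat>" "y > 0" "y\<^sup>2 = z * (z\<^sup>2 + 33 * z + 15)"
    using curve_pointsE[OF assms(1)] by metis
  define n where "n = z^4 + 66 * z^3 + 90 * z\<^sup>2 + 990 * z + 225"
  define B where "B = z * (z\<^sup>2 + 33 * z + 15)"
  have B: "B = y\<^sup>2" "B > 0" using y(2) y(3)[folded B_def] by auto
  have d: "double_z z = ((z\<^sup>2 - 15) / (2 * y))\<^sup>2"
    by (simp add: double_z_def B_def[symmetric] B(1) power_divide power_mult_distrib)
  have n: "n\<^sup>2 = ((z\<^sup>2-15)\<^sup>2)\<^sup>2 + 132 * (z\<^sup>2-15)\<^sup>2 * B + 240 * B\<^sup>2"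
    unfolding n_def B_def by algebra
  have q: "(n / (4 * B))\<^sup>2 = (double_z z)\<^sup>2 + 33 * double_z z + 15"
    using B(2) unfolding double_z_def B_def[symmetric] power_divide n
    by (simp add: field_simps power2_eq_square)
  have "((z\<^sup>2 - 15) / (2 * y) * (n / (4 * B)))\<^sup>2 = double_z z * ((double_z z)\<^sup>2 + 33 * double_z z + 15)"
    unfolding power_mult_distrib d[symmetric] q ..
  moreover have "(z\<^sup>2 - 15) / (2 * y) * (n / (4 * B)) \<in> \<rat>"
    using z(1) y(1) unfolding n_def B_def
    by (intro Rats_mult Rats_divide Rats_diff Rats_add Rats_power Rats_number_of)
  moreover have "double_z z \<in> \<rat>"
    using z(1) unfolding double_z_def
    by (intro Rats_mult Rats_divide Rats_diff Rats_add Rats_power Rats_number_of)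
  moreover have "double_z z > 0"
    using assms(2) y(2) unfolding d by simp
  ultimately show ?thesis by (intro curve_pointsI)
qed

text \<open>Once 2 divides the denominator of \<open>z\<close>, doubling lowers the 2-adic valuation by exactly 2:
  every term of numerator and denominator other than the leading one in \<open>a\<close> carries a factor
  \<open>2\<^sup>k\<close>, so the two remain odd, and the only new power of 2 is the 4 of the duplication formula.
  Such a point therefore has infinite order.\<close>

lemma double_z_two_adic:
  fixes a b :: int
  assumes "odd a" "odd b" "k > 0"
  obtains a' b' :: int where "odd a'" "odd b'"
    "double_z (of_int a / (2 ^ k * of_int b)) = of_int a' / (2 ^ (k + 2) * of_int b')"
proof
  let ?a' = "(a\<^sup>2 - 15 * (2 ^ k * b)\<^sup>2)\<^sup>2"
  let ?b' = "b * a * (a\<^sup>2 + 33 * a * (2 ^ k * b) + 15 * (2 ^ k * b)\<^sup>2)"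
  show "odd ?a'" "odd ?b'" using assms by auto
  define c :: real where "c = 2 ^ k * of_int b"
  define a1 :: real where "a1 = of_int a"
  have c: "c \<noteq> 0" "of_int b \<noteq> (0::real)" and a1: "a1 \<noteq> 0" using assms by (auto simp: c_def a1_def)
  define g where "g = a1\<^sup>2 + 33 * a1 * c + 15 * c\<^sup>2"
  have "g = of_int (a\<^sup>2 + 33 * a * (2 ^ k * b) + 15 * (2 ^ k * b)\<^sup>2)"
    by (simp add: g_def a1_def c_def)
  moreover have "odd (a\<^sup>2 + 33 * a * (2 ^ k * b) + 15 * (2 ^ k * b)\<^sup>2)" using assms by auto
  ultimately have g: "g \<noteq> 0" by (metis even_zero of_int_eq_0_iff)
  have e1: "(a1 / c)\<^sup>2 - 15 = (a1\<^sup>2 - 15 * c\<^sup>2) / c\<^sup>2"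
    using c by (simp add: power_divide field_simps)
  have e2: "(a1 / c)\<^sup>2 + 33 * (a1 / c) + 15 = g / c\<^sup>2"
    using c by (simp add: g_def power_divide field_simps power2_eq_square)
  have "double_z (a1 / c) = (a1\<^sup>2 - 15 * c\<^sup>2)\<^sup>2 / (4 * c * a1 * g)"
    unfolding double_z_def e1 e2 using c a1 g by (simp add: field_simps power2_eq_square)
  also have "4 * c * a1 * g = 2 ^ (k + 2) * of_int ?b'"
    by (simp add: c_def a1_def g_def)
  also have "(a1\<^sup>2 - 15 * c\<^sup>2)\<^sup>2 = of_int ?a'"
    by (simp add: c_def a1_def)
  finally show "double_z (of_int a / (2 ^ k * of_int b)) = of_int ?a' / (2 ^ (k + 2) * of_int ?b')"
    by (simp only: a1_def c_def)
qed

lemma two_power_denom_unique: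
  fixes a b a' b' :: int
  assumes "odd a" "odd b" "odd a'" "odd b'"
    and "of_int a / (2 ^ k * of_int b) = (of_int a' / (2 ^ l * of_int b') :: real)"
  shows "k = l"
proof -
  have "b \<noteq> 0" "b' \<noteq> 0" using assms by auto
  hence "of_int (a * b' * 2 ^ l) = (of_int (a' * b * 2 ^ k) :: real)"
    using assms(5) by (simp add: field_simps)
  hence e: "a * b' * 2 ^ l = a' * b * 2 ^ k" by (simp only: of_int_eq_iff)
  have m: "multiplicity 2 (u * 2 ^ n) = n" if "odd u" for u :: int and n
    using that by (simp add: multiplicity_times_same multiplicity_prime_elem_times_other not_dvd_imp_multiplicity_0 mult.commute prime_elem_multiplicity_mult_distrib)
  show ?thesis using m[of "a * b'" l] m[of "a' * b" k] e assms by auto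
qed

text \<open>The point \<open>(-20, 70)\<close> of the oval has the double \<open>z = 121/16\<close>, whose denominator is even;
  its iterated doubles have the pairwise distinct 2-adic valuations \<open>-(2n + 4)\<close>.\<close>

lemma infinite_curve_points: "infinite curve_points"
proof -
  define z where "z n = (double_z ^^ n) (121 / 16)" for n
  have form: "\<exists>a b :: int. odd a \<and> odd b \<and> z n = of_int a / (2 ^ (2 * n + 4) * of_int b)" for n
  proof (induction n)
    case 0
    show ?case by (rule exI[of _ 121], rule exI[of _ 1]) (simp add: z_def)
  next
    case (Suc n)
    then obtain a b :: int where ab: "odd a" "odd b" "z n = of_int a / (2 ^ (2 * n + 4) * of_int b)"
      by blast
    obtain a' b' :: int where "odd a'" "odd b'"
      "double_z (z n) = of_int a' / (2 ^ (2 * n + 4 + 2) * of_int b')"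
      using double_z_two_adic[OF ab(1,2), of "2 * n + 4"] ab(3) by auto
    thus ?case by (intro exI[of _ a'] exI[of _ b']) (simp add: z_def)
  qed
  have "z n \<in> curve_points" for n
  proof (induction n)
    case 0
    show ?case
      by (rule curve_pointsI[of _ "11 * 287 / 64"]) (auto simp: z_def power2_eq_square)
  next
    case (Suc n)
    obtain a b :: int where ab: "odd a" "odd b" "z n = of_int a / (2 ^ (2 * n + 4) * of_int b)"
      using form by blast
    have "(z n)\<^sup>2 \<noteq> 15"
    proof
      assume "(z n)\<^sup>2 = 15"
      moreover have "of_int b \<noteq> (0::real)" using ab by auto
      ultimately have "real_of_int (a\<^sup>2) = of_int (15 * (2 ^ (2 * n + 4) * b)\<^sup>2)"
        unfolding ab(3) by (simp add: power_divide field_simps)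
      hence "a\<^sup>2 = 15 * (2 ^ (2 * n + 4) * b)\<^sup>2" by (simp only: of_int_eq_iff)
      moreover have "odd (a\<^sup>2)" using ab by simp
      moreover have "even (15 * (2 ^ (2 * n + 4) * b)\<^sup>2)" by simp
      ultimately show False by metis
    qed
    thus ?case using double_curve_points[OF Suc] by (simp add: z_def)
  qed
  moreover have "inj z"
  proof (rule injI)
    fix m n assume "z m = z n"
    hence "2 * m + 4 = 2 * n + 4"
      using form[of m] form[of n] by (metis two_power_denom_unique)
    thus "m = n" by simp
  qed
  ultimately show ?thesis
    by (meson image_subsetI infinite_iff_countable_subset)
qed

text \<open>Translation by the 2-torsion point \<open>(0, 0)\<close>. It exchanges the neighbourhood of \<open>z = 0\<close> with
  the neighbourhood of infinity.\<close>

lemma curve_points_inverse: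
  assumes "z \<in> curve_points"
  shows "15 / z \<in> curve_points"
proof -
  obtain y where z: "z \<in> \<rat>" "z > 0" and y: "y \<in> \<rat>" "y > 0" "y\<^sup>2 = z * (z\<^sup>2 + 33 * z + 15)"
    using curve_pointsE[OF assms] by metis
  show ?thesis
  proof (rule curve_pointsI[of _ "15 * y / z\<^sup>2"])
    show "(15 * y / z\<^sup>2)\<^sup>2 = 15 / z * ((15 / z)\<^sup>2 + 33 * (15 / z) + 15)"
      unfolding power_divide power_mult_distrib y(3)
      using z(2) by (simp add: field_simps power2_eq_square)
  qed (use z y in auto)
qed

text \<open>The difference of two points, \<open>(z1, y1)\<close> and \<open>(z2, y2)\<close>: the line through \<open>(z1, y1)\<close> and
  \<open>(z2, -y2)\<close> has slope \<open>s = (y1 + y2) / (z1 - z2)\<close> and meets the curve a third time at \<open>z3\<close>, since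
  the three roots of a monic cubic add up to minus its quadratic coefficient.\<close>

lemma chord_curve_points:
  assumes z1: "z1 \<in> \<rat>" "y1 \<in> \<rat>" "y1\<^sup>2 = z1 * (z1\<^sup>2 + 33 * z1 + 15)"
    and z2: "z2 \<in> \<rat>" "y2 \<in> \<rat>" "y2\<^sup>2 = z2 * (z2\<^sup>2 + 33 * z2 + 15)"
    and ne: "z1 \<noteq> z2"
    and z3: "z3 = ((y1 + y2) / (z1 - z2))\<^sup>2 - 33 - z1 - z2" "z3 > 0"
  shows "z3 \<in> curve_points"
proof (rule curve_pointsI)
  define s where "s = (y1 + y2) / (z1 - z2)"
  have s: "s * (z1 - z2) = y1 + y2" using ne by (simp add: s_def)
  have "(z1 - z2) * (z3 * (z3\<^sup>2 + 33 * z3 + 15)) = (z1 - z2) * (y1 + s * (z3 - z1))\<^sup>2"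
    using s z1(3) z2(3) z3(1)[folded s_def] by algebra
  thus "(y1 + s * (z3 - z1))\<^sup>2 = z3 * (z3\<^sup>2 + 33 * z3 + 15)" using ne by simp
  show "z3 \<in> \<rat>" "y1 + s * (z3 - z1) \<in> \<rat>" unfolding z3(1) s_def using z1(1,2) z2(1,2)
    by (simp_all add: Rats_mult Rats_divide Rats_diff Rats_add Rats_power)
  show "z3 > 0" by fact
qed

text \<open>Differences of nearby points are close to the point at infinity. If \<open>z\<close> were bounded by
  \<open>M\<close>, then by \<open>z \<mapsto> 15/z\<close> it would also be bounded below by \<open>15/M\<close>. The infinitely many points
  would thus lie in a compact set away from \<open>y = 0\<close> and two of them would be arbitrarily close, so
  that the slope of the chord defining their difference, and with it \<open>z\<close>, would exceed every
  bound.\<close>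

lemma curve_points_unbounded: "\<exists>z\<in>curve_points. z > M"
proof (rule ccontr)
  assume "\<not> (\<exists>z\<in>curve_points. z > M)"
  hence le: "z \<le> M" if "z \<in> curve_points" for z using that by force
  have pos: "z > 0" if "z \<in> curve_points" for z using that by (simp add: curve_points_def)
  obtain z0 where "z0 \<in> curve_points" using infinite_curve_points by fastforce
  hence M: "M > 0" using le pos by fastforce
  have ge: "z \<ge> 15 / M" if "z \<in> curve_points" for z
    using le[OF curve_points_inverse[OF that]] pos[OF that] M by (simp add: field_simps)
  \<comment> \<open>chosen so that \<open>(y1 + y2)\<^sup>2 \<ge> 225/M\<close> and \<open>|z1 - z2| < \<eta>\<close> give a squared slope above \<open>33 + 3M\<close>\<close>
  define \<eta> where "\<eta> = sqrt (225 / (M * (33 + 3 * M)))"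
  have \<eta>: "\<eta> > 0" "\<eta>\<^sup>2 = 225 / (M * (33 + 3 * M))" using M by (auto simp: \<eta>_def)
  obtain p where "p islimpt curve_points"
  proof -
    have "compact {0..M}" "curve_points \<subseteq> {0..M}" using le pos by (auto simp: less_imp_le)
    thus thesis using infinite_curve_points that
      by (meson compact_eq_Bolzano_Weierstrass)
  qed
  then obtain z1 z2 where z: "z1 \<in> curve_points" "z2 \<in> curve_points" "dist z1 z2 < \<eta>" "z1 \<noteq> z2"
    using discrete_imp_not_islimpt[OF \<eta>(1)] by metis
  obtain y1 where y1: "z1 \<in> \<rat>" "y1 \<in> \<rat>" "y1 > 0" "y1\<^sup>2 = z1 * (z1\<^sup>2 + 33 * z1 + 15)"
    using curve_pointsE[OF z(1)] by metis
  obtain y2 where y2: "z2 \<in> \<rat>" "y2 \<in> \<rat>" "y2 > 0" "y2\<^sup>2 = z2 * (z2\<^sup>2 + 33 * z2 + 15)"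
    using curve_pointsE[OF z(2)] by metis
  have zpos: "z1 > 0" "z2 > 0" using z pos by auto
  have "225 / M = 15 * (15 / M)" by simp
  also have "\<dots> \<le> z1 * 15" using ge[OF z(1)] by simp
  also have "\<dots> \<le> y1\<^sup>2" unfolding y1(4) using zpos by (intro mult_left_mono) auto
  also have "\<dots> \<le> (y1 + y2)\<^sup>2" using y1 y2 by (intro power_mono) auto
  finally have num: "225 / M \<le> (y1 + y2)\<^sup>2" .
  have den: "(z1 - z2)\<^sup>2 < \<eta>\<^sup>2"
    using power_strict_mono[of "\<bar>z1 - z2\<bar>" \<eta> 2] z(3) by (simp add: dist_real_def)
  have "33 + 3 * M = (225 / M) / \<eta>\<^sup>2" using M by (simp add: \<eta>(2) field_simps)
  also have "\<dots> < (225 / M) / (z1 - z2)\<^sup>2"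
    using den z(4) M \<eta>(1) by (intro divide_strict_left_mono) auto
  also have "\<dots> \<le> (y1 + y2)\<^sup>2 / (z1 - z2)\<^sup>2" using num by (intro divide_right_mono) auto
  also have "\<dots> = ((y1 + y2) / (z1 - z2))\<^sup>2" by (simp add: power_divide)
  finally have big: "((y1 + y2) / (z1 - z2))\<^sup>2 - 33 - z1 - z2 > M" using le[OF z(1)] le[OF z(2)] by simp
  have "((y1 + y2) / (z1 - z2))\<^sup>2 - 33 - z1 - z2 \<in> curve_points"
    using big M by (intro chord_curve_points[OF y1(1,2,4) y2(1,2,4) z(4) refl]) auto
  from le[OF this] big show False by simp
qed

section \<open>Infinitely many genuine pairs\<close>

text \<open>The change of variables between \<open>E\<close> and the quartic \<open>v\<^sup>2 = Q(w)\<close> of the geometric problem.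
  As \<open>Q(w)\<close> vanishes at \<open>w = 1/2\<close>, that point can be sent to infinity, which turns the quartic
  into a cubic. Large \<open>z\<close> corresponds to \<open>w\<close> slightly above \<open>1/2\<close>; the bound 250 keeps \<open>w\<close> below
  \<open>1 / sqrt 3\<close>.\<close>

lemma curve_point_parameter:
  assumes "z \<in> curve_points" "z > 250"
  defines "w \<equiv> (z + 20) / (2 * (z - 15))"
  shows "w \<in> \<rat>" "w > 1/2" "3 * w\<^sup>2 < 1"
    and "\<exists>v\<in>\<rat>. v\<^sup>2 = 36 * w^4 + 24 * w^3 - 12 * w\<^sup>2 - 13/2 * w + 1"
proof -
  obtain y where z: "z \<in> \<rat>" "z > 0" and y: "y \<in> \<rat>" "y > 0" "y\<^sup>2 = z * (z\<^sup>2 + 33 * z + 15)"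
    using curve_pointsE[OF assms(1)] by metis
  show "w \<in> \<rat>" unfolding w_def using z(1) by (intro Rats_mult Rats_divide Rats_diff Rats_add Rats_number_of)
  show "w > 1/2" unfolding w_def using assms(2) by (simp add: field_simps)
  moreover have "w < 27/47" unfolding w_def using assms(2) by (simp add: field_simps)
  ultimately have "w\<^sup>2 < (27/47)\<^sup>2" by (intro power_strict_mono) auto
  thus "3 * w\<^sup>2 < 1" by (simp add: power2_eq_square)
  \<comment> \<open>\<open>w - 1/2 = 35 / (2 t)\<close>, so that \<open>Q(w) t\<^sup>4\<close> is a cubic in \<open>t\<close>, proportional to \<open>y\<^sup>2\<close>\<close>
  define t where "t = z - 15"
  have t: "t \<noteq> 0" "z = t + 15" "w = (t + 35) / (2 * t)" using assms(2) by (auto simp: t_def w_def)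
  have "(35 * y / (2 * t\<^sup>2))\<^sup>2 = 1225 * y\<^sup>2 / (4 * t^4)"
    by (simp add: power_divide power_mult_distrib)
  also have "\<dots> = 36 * w^4 + 24 * w^3 - 12 * w\<^sup>2 - 13/2 * w + 1"
    unfolding y(3) t(2,3) using t(1) by (simp add: power_divide power_mult_distrib divide_simps) algebra
  finally show "\<exists>v\<in>\<rat>. v\<^sup>2 = 36 * w^4 + 24 * w^3 - 12 * w\<^sup>2 - 13/2 * w + 1"
    using z y by (intro bexI[of _ "35 * y / (2 * t\<^sup>2)"]) (auto simp: t_def intro!: Rats_mult Rats_divide Rats_diff Rats_power)
qed

lemma infinite_parameters:
  "infinite {w \<in> \<rat>. w > 1/2 \<and> 3 * w\<^sup>2 < 1 \<and>
     (\<exists>v\<in>\<rat>. v\<^sup>2 = 36 * w^4 + 24 * w^3 - 12 * w\<^sup>2 - 13/2 * w + (1::real))}"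
    (is "infinite ?W")
proof
  let ?Z = "{z \<in> curve_points. z > 250}"
  let ?f = "\<lambda>z :: real. (z + 20) / (2 * (z - 15))"
  assume fin: "finite ?W"
  have "?f ` ?Z \<subseteq> ?W" using curve_point_parameter by blast
  moreover have "inj_on ?f ?Z"
    by (rule inj_onI) (simp add: field_simps)
  ultimately have "finite ?Z" using fin by (meson finite_subset finite_imageD)
  hence "bdd_above ?Z" by (rule bdd_above_finite)
  then obtain M where M: "\<And>z. z \<in> ?Z \<Longrightarrow> z \<le> M" by (meson bdd_above.E)
  obtain z where "z \<in> curve_points" "z > max M 250" using curve_points_unbounded by blast
  with M[of z] show False by auto
qed

theorem theorem4p5:
  shows "infinite (genuine_pairs (47/49) // same_pair (47/49))"
proof -
  let ?G = "genuine_pairs (47/49)" and ?R = "same_pair (47/49)"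
  define W where "W = {w \<in> \<rat>. w > 1/2 \<and> 3 * w\<^sup>2 < 1 \<and>
     (\<exists>v\<in>\<rat>. v\<^sup>2 = 36 * w^4 + 24 * w^3 - 12 * w\<^sup>2 - 13/2 * w + (1::real))}"
  have "\<forall>w\<in>W. \<exists>T. (T, isosceles_of w) \<in> ?G"
    unfolding W_def using genuine_pair_exists by blast
  then obtain t where t: "\<And>w. w \<in> W \<Longrightarrow> (t w, isosceles_of w) \<in> ?G" by metis
  define cls where "cls w = ?R `` {(t w, isosceles_of w)}" for w
  have "inj_on cls W"
  proof (rule inj_onI)
    fix w w' assume w: "w \<in> W" "w' \<in> W" and "cls w = cls w'"
    hence "((t w, isosceles_of w), (t w', isosceles_of w')) \<in> ?R"
      using eq_equiv_class[OF _ equiv_same_pair t[OF w(2)]] by (simp add: cls_def)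
    then obtain c where "c > 0"
      "congruent_triangles (isosceles_of w') (scale_triangle c (isosceles_of w))"
      unfolding same_pair_def by auto
    thus "w = w'" using isosceles_of_similar[of w w' c] w by (simp add: W_def)
  qed
  moreover have "infinite W" unfolding W_def by (rule infinite_parameters)
  moreover have "cls ` W \<subseteq> ?G // ?R"
    using t by (auto simp: cls_def intro: quotientI)
  ultimately show ?thesis by (meson finite_imageD finite_subset)
qed

end
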